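(* Let $X$ be a polynomial hypergroup (in $d$ variables, for some positive integer $d$). Then every exponential polynomial $f$ on $X$ is a linear combination of generalized moment functions that are contained in the variety $\tau(f)$ of $f$.
   Context: $\mathbb{N}=\{0,1,2,\dots\}$. A (discrete) commutative hypergroup is a set $X$ with a bilinear, associative, commutative convolution $*$ of bounded complex measures such that each $\delta_x*\delta_y$ is a finitely supported probability measure, with an identity $o\in X$ ($\delta_o*\delta_x=\delta_x$) and an involution $x\mapsto\check x$ with $(\delta_x*\delta_y)\check{\ }=\delta_{\check y}*\delta_{\check x}$ (image measure) and $o\in\mathrm{supp}(\delta_x*\delta_y)$ if and only if $x=\check y$. Polynomial hypergroup in $d$ variables: let $\mathcal{P}_n$ be the space of complex polynomials on $\mathbb{C}^d$ of degree at most $n$. A commutative hypergroup $X$ (with discrete topology) is a polynomial hypergroup in $d$ variables, associated with the family of polynomials $\{Q_x:x\in X\}$ on $\mathbb{C}^d$, if there is a probability measure $\pi$ on $\mathbb{C}^d$ such that: (P1) for each $n\ge0$, the polynomials $Q_x$ with $x\in X_n=\{x\in X: Q_x\in\mathcal{P}_n\}$ form a basis of $\mathcal{P}_n$; (P2) $Q_x(1,1,\dots,1)=1$ for each $x\in X$; (P3) $Q_{\check x}(z)=\overline{Q_x(z)}$ for each $x\in X$ and $z\in\mathrm{supp}\,\pi$; (P4) $\int_{\mathbb{C}^d}Q_xQ_yQ_w\,d\pi\ge0$ for all $x,y,w\in X$; and, writing $Q_xQ_y=\sum_{w\in X}c(x,y,w)Q_w$ for the unique (finite) expansion given by (P1),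 the convolution is $\delta_x*\delta_y=\sum_{w\in X}c(x,y,w)\delta_w$ for all $x,y\in X$. It is always assumed that $Q_o=1$, where $o$ is the identity of $X$. For $h:X\to\mathbb{C}$ write $h(x*y)=\int_X h\,d(\delta_x*\delta_y)$; the function $x\mapsto h(x*y)$ is the translate of $h$ by $y$. A variety on $X$ is a linear subspace of the space of all functions $X\to\mathbb{C}$ that contains all translates of its elements and is closed in the topology of uniform convergence on compact sets (here: pointwise convergence). The variety $\tau(h)$ of $h$ is the smallest variety containing $h$. An exponential polynomial is a function $f:X\to\mathbb{C}$ whose variety $\tau(f)$ is finite dimensional. A generalized moment sequence of rank $r$ (a positive integer) on $X$ is a family $(f_{\alpha})_{\alpha\in\mathbb{N}^r}$ of functions $f_\alpha:X\to\mathbb{C}$, with $f_{(0,\dots,0)}\neq0$, such that $f_{\alpha}(x*y)=\sum_{\beta\le\alpha}\binom{\alpha}{\beta}f_{\beta}(x)f_{\alpha-\beta}(y)$ for all $\alpha\in\mathbb{N}^r$ and $x,y\in X$ (multi-index notation). A generalized moment function (moment function) is a member of some generalized moment sequence of some rank. *)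

theory Defs
  imports "HOL-Probability.Probability" "HOL-Library.Function_Algebras"
begin

subsection \<open>Discrete commutative hypergroups\<close>

text \<open>
  \<open>conv x y\<close> is the measure \<open>\<delta>\<^sub>x * \<delta>\<^sub>y\<close>. On a discrete space the convolution of bounded measures
  is the bilinear extension of its values on point masses, so the axioms are stated on point
  masses only; with this extension, \<open>(\<delta>\<^sub>x * \<delta>\<^sub>y) * \<delta>\<^sub>z\<close> is \<open>bind_pmf (conv x y) (\<lambda>u. conv u z)\<close>.
\<close>

locale commutative_hypergroup =
  fixes conv :: "'x \<Rightarrow> 'x \<Rightarrow> 'x pmf"
    and e :: 'x
    and invol :: "'x \<Rightarrow> 'x"
  assumes finite_supp: "finite (set_pmf (conv x y))"
    and assoc: "bind_pmf (conv x y) (\<lambda>u. conv u z) = bind_pmf (conv y z) (\<lambda>v. conv x v)"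
    and commute: "conv x y = conv y x"
    and identity: "conv e x = return_pmf x"
    and invol_invol: "invol (invol x) = x"
    and invol_conv: "map_pmf invol (conv x y) = conv (invol y) (invol x)"
    and e_in_supp_iff: "e \<in> set_pmf (conv x y) \<longleftrightarrow> x = invol y"

subsection \<open>The complex vector space of functions\<close>

definition fscale :: "complex \<Rightarrow> ('a \<Rightarrow> complex) \<Rightarrow> 'a \<Rightarrow> complex" where
  "fscale a f = (\<lambda>x. a * f x)"

interpretation cfun: vector_space "fscale :: complex \<Rightarrow> ('a \<Rightarrow> complex) \<Rightarrow> 'a \<Rightarrow> complex"
  by standard (auto simp: fscale_def fun_eq_iff algebra_simps)

definition finite_dimensional :: "('a \<Rightarrow> complex) set \<Rightarrow> bool" where
  "finite_dimensional V \<longleftrightarrow> (\<exists>B. finite B \<and> cfun.span B = V)"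

subsection \<open>Polynomial hypergroups in several variables\<close>

text \<open>
  The number \<open>d\<close> of variables is \<open>CARD('d)\<close>. Since \<open>\<complex>\<close> is infinite, polynomials are identified with
  the functions on \<open>\<complex>\<^sup>d\<close> that they induce.
\<close>

definition monomial_fun :: "('d::finite \<Rightarrow> nat) \<Rightarrow> complex ^ 'd \<Rightarrow> complex" where
  "monomial_fun k = (\<lambda>z. \<Prod>i\<in>UNIV. (z $ i) ^ k i)"

definition polys_upto :: "nat \<Rightarrow> (complex ^ 'd::finite \<Rightarrow> complex) set" where
  "polys_upto n = cfun.span {monomial_fun k | k. (\<Sum>i\<in>UNIV. k i) \<le> n}"

definition measure_support :: "'a::topological_space measure \<Rightarrow> 'a set" where
  "measure_support M = {z. \<forall>U. open U \<and> z \<in> U \<longrightarrow> emeasure M U > 0}"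

text \<open>
  As the Bochner integral of a non-integrable function is \<open>0\<close>, the existence of the integrals
  in \<open>orthogonalizing\<close> has to be required separately.
\<close>

definition orthogonalizing ::
    "('x \<Rightarrow> 'x) \<Rightarrow> ('x \<Rightarrow> complex ^ 'd::finite \<Rightarrow> complex) \<Rightarrow> (complex ^ 'd) measure \<Rightarrow> bool" where
  "orthogonalizing invol Q \<pi> \<longleftrightarrow>
     (\<forall>x. \<forall>z\<in>measure_support \<pi>. Q (invol x) z = cnj (Q x z)) \<and>
     (\<forall>x y w. integrable \<pi> (\<lambda>z. Q x z * Q y z * Q w z) \<and>
              (\<integral>z. Q x z * Q y z * Q w z \<partial>\<pi>) \<in> \<real>\<^sub>\<ge>\<^sub>0)"

text \<open>
  By \<open>basis\<close> the expansion of \<open>Q x * Q y\<close> in the family \<open>Q\<close> is unique, so \<open>linearization\<close> says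
  that \<open>c(x,y,w) = (\<delta>\<^sub>x * \<delta>\<^sub>y)({w})\<close> for all \<open>w\<close>.
\<close>

locale polynomial_hypergroup = commutative_hypergroup conv e invol
  for conv :: "'x \<Rightarrow> 'x \<Rightarrow> 'x pmf" and e :: 'x and invol :: "'x \<Rightarrow> 'x" +
  fixes Q :: "'x \<Rightarrow> complex ^ 'd::finite \<Rightarrow> complex"
  assumes polynomial: "\<exists>n. Q x \<in> polys_upto n"
    and basis: "inj_on Q {x. Q x \<in> polys_upto n}"
      "cfun.independent (Q ` {x. Q x \<in> polys_upto n})"
      "cfun.span (Q ` {x. Q x \<in> polys_upto n}) = polys_upto n"
    and normalized: "Q x (\<chi> i. 1) = 1"
    and ex_measure: "\<exists>\<pi>. prob_space \<pi> \<and> sets \<pi> = sets borel \<and> orthogonalizing invol Q \<pi>"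
    and linearization:
      "Q x z * Q y z = (\<Sum>w\<in>set_pmf (conv x y). complex_of_real (pmf (conv x y) w) * Q w z)"
    and Q_identity: "Q e = (\<lambda>z. 1)"

subsection \<open>Varieties and exponential polynomials\<close>

definition conv_eval :: "('x \<Rightarrow> 'x \<Rightarrow> 'x pmf) \<Rightarrow> ('x \<Rightarrow> complex) \<Rightarrow> 'x \<Rightarrow> 'x \<Rightarrow> complex" where
  "conv_eval conv h x y = (\<integral>w. h w \<partial>measure_pmf (conv x y))"

definition translate :: "('x \<Rightarrow> 'x \<Rightarrow> 'x pmf) \<Rightarrow> 'x \<Rightarrow> ('x \<Rightarrow> complex) \<Rightarrow> 'x \<Rightarrow> complex" where
  "translate conv y h = (\<lambda>x. conv_eval conv h x y)"

text \<open>
  The topology on the function type is the product topology, i.e. that of pointwise convergence,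
  which on a discrete space is uniform convergence on compact sets.
\<close>

definition variety :: "('x \<Rightarrow> 'x \<Rightarrow> 'x pmf) \<Rightarrow> ('x \<Rightarrow> complex) set \<Rightarrow> bool" where
  "variety conv V \<longleftrightarrow> cfun.subspace V \<and> (\<forall>h\<in>V. \<forall>y. translate conv y h \<in> V) \<and> closed V"

definition variety_of :: "('x \<Rightarrow> 'x \<Rightarrow> 'x pmf) \<Rightarrow> ('x \<Rightarrow> complex) \<Rightarrow> ('x \<Rightarrow> complex) set" where
  "variety_of conv h = variety conv hull {h}"

lemma variety_variety_of: "variety conv (variety_of conv h)"
  unfolding variety_of_def
proof (rule hull_in)
  fix T assume "\<forall>V\<in>T. variety conv V"
  then show "variety conv (\<Inter>T)"
    unfolding variety_def by (auto intro!: cfun.subspace_Inter closed_Inter)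
qed

definition exponential_polynomial :: "('x \<Rightarrow> 'x \<Rightarrow> 'x pmf) \<Rightarrow> ('x \<Rightarrow> complex) \<Rightarrow> bool" where
  "exponential_polynomial conv f \<longleftrightarrow> finite_dimensional (variety_of conv f)"

subsection \<open>Generalized moment functions\<close>

text \<open>
  The rank is quantified existentially in \<open>moment_function\<close>, so \<open>\<nat>\<^sup>r\<close> is represented by the functions
  \<open>nat \<Rightarrow> nat\<close> vanishing outside \<open>{..<r}\<close>; order and subtraction on them are pointwise. Only the
  members \<open>f \<alpha>\<close> with \<open>\<alpha> \<in> multi_indices r\<close> belong to the sequence.
\<close>

definition multi_indices :: "nat \<Rightarrow> (nat \<Rightarrow> nat) set" where
  "multi_indices r = {\<alpha>. \<forall>i\<ge>r. \<alpha> i = 0}"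

definition multi_choose :: "nat \<Rightarrow> (nat \<Rightarrow> nat) \<Rightarrow> (nat \<Rightarrow> nat) \<Rightarrow> nat" where
  "multi_choose r \<alpha> \<beta> = (\<Prod>i<r. \<alpha> i choose \<beta> i)"

lemma finite_multi_indices_le: "finite {\<beta> \<in> multi_indices r. \<beta> \<le> \<alpha>}"
proof (rule finite_subset)
  show "{\<beta> \<in> multi_indices r. \<beta> \<le> \<alpha>} \<subseteq> {\<beta>. \<forall>i. (i \<in> {..<r} \<longrightarrow> \<beta> i \<in> {..Max (\<alpha> ` {..<r})}) \<and> (i \<notin> {..<r} \<longrightarrow> \<beta> i = 0)}"
    by (auto simp: multi_indices_def le_fun_def intro: order_trans Max_ge)
  show "finite {\<beta>. \<forall>i. (i \<in> {..<r} \<longrightarrow> \<beta> i \<in> {..Max (\<alpha> ` {..<r})}) \<and> (i \<notin> {..<r} \<longrightarrow> \<beta> i = 0)}"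
    by (rule finite_set_of_finite_funs) auto
qed

definition moment_sequence ::
    "('x \<Rightarrow> 'x \<Rightarrow> 'x pmf) \<Rightarrow> nat \<Rightarrow> ((nat \<Rightarrow> nat) \<Rightarrow> 'x \<Rightarrow> complex) \<Rightarrow> bool" where
  "moment_sequence conv r f \<longleftrightarrow>
     r > 0 \<and> f (\<lambda>i. 0) \<noteq> (\<lambda>x. 0) \<and>
     (\<forall>\<alpha>\<in>multi_indices r. \<forall>x y.
        conv_eval conv (f \<alpha>) x y =
          (\<Sum>\<beta> | \<beta> \<in> multi_indices r \<and> \<beta> \<le> \<alpha>. of_nat (multi_choose r \<alpha> \<beta>) * f \<beta> x * f (\<alpha> - \<beta>) y))"

definition moment_function :: "('x \<Rightarrow> 'x \<Rightarrow> 'x pmf) \<Rightarrow> ('x \<Rightarrow> complex) \<Rightarrow> bool" where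
  "moment_function conv g \<longleftrightarrow>
     (\<exists>r f. moment_sequence conv r f \<and> (\<exists>\<alpha>\<in>multi_indices r. g = f \<alpha>))"

end

theory Submission
  imports Defs "HOL-Computational_Algebra.Polynomial_Factorial"
    "HOL-Computational_Algebra.Fundamental_Theorem_Algebra"
    "HOL-Computational_Algebra.Field_as_Ring"
begin

text \<open>
  Since the \<open>Q x\<close> form a basis of the polynomials, a function \<open>h\<close> on the hypergroup is the same thing
  as a linear functional \<open>L\<close> on the polynomials with \<open>L (Q x) = h x\<close>. The linearization formula turns
  translation by \<open>y\<close> into the operation \<open>p \<mapsto> L (Q y * p)\<close>, so varieties become modules over
  the ring of polynomials (\<open>act_in_variety\<close>).

  A finite-dimensional variety is a torsion module: each coordinate \<open>z\<^sub>i\<close> satisfies a polynomial equation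
  on it. Splitting these equations by the Bezout identity, one coordinate after the other, writes \<open>f\<close>
  as a sum of elements \<open>g\<close> of its variety that are killed by a power of \<open>z\<^sub>i - c\<^sub>i\<close> for each \<open>i\<close>
  (\<open>primary_decomposition\<close>). It remains to treat such a \<open>g\<close>, whose functional depends only on finitely
  many Taylor coefficients at the point \<open>c\<close>.

  A polynomial curve \<open>\<gamma>\<close> in \<open>\<complex>\<^sup>d\<close> gives a ring homomorphism \<open>p \<mapsto> p \<circ> \<gamma>\<close> into the univariate
  polynomials. Multiplicativity says exactly that the functions \<open>n! [t\<^sup>n] Q x (\<gamma> t)\<close> form a moment
  sequence of rank one (\<open>moment_function_of_curve\<close>). The heart of the proof is that a single coefficient
  along a single curve through \<open>c\<close> can realize every functional that sees only finitely many Taylor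
  coefficients at \<open>c\<close> and ignores the constant term (\<open>curve_functional_finite_support\<close>).
  Two functionals given by \<open>[t\<^sup>m]\<close> along \<open>\<psi>\<close> and \<open>[t\<^sup>n]\<close> along \<open>\<phi>\<close>, where \<open>m\<close> and \<open>n\<close> are coprime, are added by
  taking \<open>[t\<^sup>m\<^sup>n]\<close> along \<open>\<psi> (t\<^sup>n) + \<phi> (t\<^sup>m)\<close>: a mixed term has an exponent \<open>i n + j m\<close> with
  \<open>i, j > 0\<close>, which is never \<open>m n\<close>. A similar substitution multiplies the dual monomial by a variable.

  The constant term is accounted for by evaluation at \<open>c\<close>, which is itself a moment function and lies in
  the variety of \<open>g\<close> if \<open>g \<noteq> 0\<close>: multiply \<open>g\<close> by a product of the \<open>z\<^sub>i - c\<^sub>i\<close> that is as long as possible without killing it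
  (\<open>local_evaluation_in_variety\<close>). Hence \<open>g\<close> is a combination of at most two moment functions of its variety.
\<close>

section \<open>Coefficients along polynomial curves\<close>

lemma coeff_pcompose_monom:
  fixes p :: "'a::comm_ring_1 poly"
  assumes "a > 0"
  shows "coeff (pcompose p (monom 1 a)) k = (if a dvd k then coeff p (k div a) else 0)"
proof (induction p arbitrary: k)
  case (pCons c p)
  show ?case
  proof (cases "k < a")
    case True
    with assms show ?thesis
      by (cases "k = 0") (auto simp: pcompose_pCons coeff_monom_mult coeff_pCons dvd_imp_le split: nat.splits)
  next
    case False
    then obtain l where l: "k = l + a" by (metis add.commute le_Suc_ex not_less)
    have "coeff [:c:] k = 0" using l assms by (auto simp: coeff_pCons split: nat.splits)
    moreover have "(l + a) div a = Suc (l div a)" using assms by simp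
    moreover have "a dvd l + a \<longleftrightarrow> a dvd l" by simp
    ultimately show ?thesis using l
      by (simp add: pcompose_pCons coeff_monom_mult pCons.IH)
  qed
qed auto

lemma pcompose_power: "pcompose (p ^ n) q = pcompose p q ^ n"
  for p q :: "'a::comm_ring_1 poly"
  by (induction n) (simp_all add: pcompose_mult pcompose_1)

definition supported_in :: "nat set \<Rightarrow> 'a::zero poly \<Rightarrow> bool" where
  "supported_in A p \<longleftrightarrow> (\<forall>k. coeff p k \<noteq> 0 \<longrightarrow> k \<in> A)"

lemma supported_in_add:
  "supported_in A p \<Longrightarrow> supported_in A q \<Longrightarrow> supported_in A (p + q)"
  by (auto simp: supported_in_def) (metis add_0)

lemma supported_in_mult:
  assumes "supported_in A p" "supported_in B q" "\<And>i j. i \<in> A \<Longrightarrow> j \<in> B \<Longrightarrow> i + j \<in> C"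
  shows "supported_in C (p * q)"
  unfolding supported_in_def
proof (intro allI impI)
  fix k assume "coeff (p * q) k \<noteq> 0"
  then obtain i where "i \<le> k" "coeff p i * coeff q (k - i) \<noteq> 0"
    unfolding coeff_mult by (meson atMost_iff sum.neutral)
  then have "coeff p i \<noteq> 0" "coeff q (k - i) \<noteq> 0" by auto
  then have "i \<in> A" "k - i \<in> B" using assms(1,2) unfolding supported_in_def by blast+
  then show "k \<in> C" using assms(3)[of i "k - i"] \<open>i \<le> k\<close> by simp
qed

text \<open>
  This describes an expansion of a product \<open>r\<close> of sums, where one summand of each factor is a polynomial in
  \<open>t\<^sup>a\<close> and the other one a polynomial in \<open>t\<^sup>b\<close>, all without constant term: \<open>p\<close> and \<open>q\<close> are the products of
  the first and of the second summands, and what is left consists of genuinely mixed terms.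
\<close>

definition pure_parts :: "nat \<Rightarrow> nat \<Rightarrow> complex poly \<Rightarrow> complex poly \<Rightarrow> complex poly \<Rightarrow> bool" where
  "pure_parts a b r p q \<longleftrightarrow>
     supported_in {a * i | i. i > 0} p \<and> supported_in {b * j | j. j > 0} q \<and>
     supported_in {a * i + b * j | i j. i > 0 \<and> j > 0} (r - p - q)"

lemma pure_parts_mult:
  assumes "pure_parts a b r p q" "pure_parts a b r' p' q'"
  shows "pure_parts a b (r * r') (p * p') (q * q')"
proof -
  let ?A = "{a * i | i. i > 0}" and ?B = "{b * j | j. j > 0}"
    and ?C = "{a * i + b * j | i j. i > 0 \<and> j > 0}"
  have AA: "x + y \<in> ?A" if "x \<in> ?A" "y \<in> ?A" for x y
    using that by (auto simp: distrib_left[symmetric])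
  have BB: "x + y \<in> ?B" if "x \<in> ?B" "y \<in> ?B" for x y
    using that by (auto simp: distrib_left[symmetric])
  have AB: "x + y \<in> ?C" if "x \<in> ?A" "y \<in> ?B" for x y
    using that by auto
  have BA: "x + y \<in> ?C" if "x \<in> ?B" "y \<in> ?A" for x y
    using AB[OF that(2,1)] by (simp add: add.commute)
  have AC: "x + y \<in> ?C" if "x \<in> ?A" "y \<in> ?C" for x y
  proof -
    from that obtain i j k where *: "x = a * i" "y = a * j + b * k" "i > 0" "j > 0" "k > 0" by auto
    then have "x + y = a * (i + j) + b * k" by (simp add: algebra_simps)
    moreover have "i + j > 0" using * by simp
    ultimately show ?thesis using *(5) by blast
  qed
  have BC: "x + y \<in> ?C" if "x \<in> ?B" "y \<in> ?C" for x y
  proof -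
    from that obtain i j k where *: "x = b * i" "y = a * j + b * k" "i > 0" "j > 0" "k > 0" by auto
    then have "x + y = a * j + b * (i + k)" by (simp add: algebra_simps)
    moreover have "i + k > 0" using * by simp
    ultimately show ?thesis using *(4) by blast
  qed
  have CC: "x + y \<in> ?C" if "x \<in> ?C" "y \<in> ?C" for x y
  proof -
    from that(1) obtain i j where "x = a * i + b * j" "i > 0" "j > 0" by auto
    then have "b * j \<in> ?B" "a * i \<in> ?A" by blast+
    from AC[OF this(2) BC[OF this(1) that(2)]] show ?thesis
      unfolding \<open>x = a * i + b * j\<close> add.assoc .
  qed
  have p: "supported_in ?A p" "supported_in ?A p'" and q: "supported_in ?B q" "supported_in ?B q'"
    and c: "supported_in ?C (r - p - q)" "supported_in ?C (r' - p' - q')"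
    using assms by (auto simp: pure_parts_def)
  have "r * r' - p * p' - q * q' =
      p * q' + q * p' + (p * (r' - p' - q') + q * (r' - p' - q'))
      + (p' * (r - p - q) + q' * (r - p - q)) + (r - p - q) * (r' - p' - q')"
    by (simp add: algebra_simps)
  moreover have "supported_in ?C \<dots>"
    by (intro supported_in_add supported_in_mult[OF p(1) q(2) AB] supported_in_mult[OF q(1) p(2) BA]
        supported_in_mult[OF p(1) c(2) AC] supported_in_mult[OF p(2) c(1) AC]
        supported_in_mult[OF q(1) c(2) BC] supported_in_mult[OF q(2) c(1) BC]
        supported_in_mult[OF c CC])
  ultimately show ?thesis
    using supported_in_mult[OF p AA] supported_in_mult[OF q BB] unfolding pure_parts_def by simp
qed

lemma pure_parts_power: "pure_parts a b r p q \<Longrightarrow> n > 0 \<Longrightarrow> pure_parts a b (r ^ n) (p ^ n) (q ^ n)"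
proof (induction n)
  case (Suc n)
  then show ?case by (cases "n = 0") (auto intro: pure_parts_mult)
qed simp

lemma pure_parts_prod:
  assumes "finite I" "I \<noteq> {}" "\<And>i. i \<in> I \<Longrightarrow> pure_parts a b (r i) (p i) (q i)"
  shows "pure_parts a b (prod r I) (prod p I) (prod q I)"
  using assms by (induction rule: finite_ne_induct) (auto intro: pure_parts_mult)

lemma supported_in_pcompose_monom:
  assumes "a > 0" "coeff p 0 = 0"
  shows "supported_in {a * i | i. i > 0} (pcompose p (monom 1 a) :: complex poly)"
  using assms by (auto simp: supported_in_def coeff_pcompose_monom split: if_splits elim!: dvdE)
    (metis gr0I)

text \<open>
  The family \<open>c\<close> stands for the functional that maps the Taylor monomial with exponents \<open>m\<close> to \<open>c m\<close>. It is required
  to be the \<open>n\<close>-th coefficient along a curve \<open>\<psi>\<close> through the origin. The modulus \<open>M\<close> makes the set of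
  such families closed under addition, which needs two coprime indices: after a curve for the first summand
  has been chosen, its index can be prescribed as modulus for the second.
\<close>

definition curve_functional :: "(('d::finite \<Rightarrow> nat) \<Rightarrow> complex) \<Rightarrow> bool" where
  "curve_functional c \<longleftrightarrow>
     (\<forall>M>0. \<exists>n>0. \<exists>\<psi>. coprime n M \<and> (\<forall>i. coeff (\<psi> i) 0 = 0) \<and>
        (\<forall>m. coeff (\<Prod>i\<in>UNIV. \<psi> i ^ m i) n = c m))"

text \<open>
  With coprime indices \<open>n1\<close> and \<open>n2\<close>, reparametrize the curves by \<open>t\<^sup>n\<^sup>2\<close> and \<open>t\<^sup>n\<^sup>1\<close> and add them. A mixed
  term has an exponent \<open>n2 i + n1 j\<close> with \<open>i, j > 0\<close>; if that were \<open>n1 n2\<close>, then \<open>n1\<close> would divide \<open>i\<close>,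
  which leaves no room for \<open>j\<close>. So the coefficient at \<open>n1 n2\<close> is the sum of the two given ones.
\<close>

lemma curve_functional_add:
  assumes "curve_functional c" "curve_functional d"
  shows "curve_functional (\<lambda>m. c m + d m)"
  unfolding curve_functional_def
proof (intro allI impI)
  fix M :: nat assume "M > 0"
  then obtain n1 \<psi>1 where 1: "n1 > 0" "coprime n1 M" "\<And>i. coeff (\<psi>1 i) 0 = 0"
      "\<And>m. coeff (\<Prod>i\<in>UNIV. \<psi>1 i ^ m i) n1 = c m"
    using assms(1) unfolding curve_functional_def by metis
  then have "M * n1 > 0" using \<open>M > 0\<close> by simp
  then obtain n2 \<psi>2 where 2: "n2 > 0" "coprime n2 (M * n1)" "\<And>i. coeff (\<psi>2 i) 0 = 0"
      "\<And>m. coeff (\<Prod>i\<in>UNIV. \<psi>2 i ^ m i) n2 = d m"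
    using assms(2) unfolding curve_functional_def by metis
  define p where "p i = pcompose (\<psi>1 i) (monom 1 n2)" for i
  define q where "q i = pcompose (\<psi>2 i) (monom 1 n1)" for i
  have p0: "coeff (p i) 0 = 0" and q0: "coeff (q i) 0 = 0" for i
    using 1(1,3) 2(1,3) by (simp_all add: p_def q_def coeff_pcompose_monom poly_0_coeff_0)
  have eq: "coeff (\<Prod>i\<in>UNIV. (p i + q i) ^ m i) (n1 * n2) = c m + d m" for m
  proof (cases "\<forall>i. m i = 0")
    case True
    then show ?thesis using 1(1) 2(1) 1(4)[of m] 2(4)[of m] by simp
  next
    case False
    let ?I = "{i. m i > 0}"
    have red: "(\<Prod>i\<in>UNIV. r i ^ m i) = (\<Prod>i\<in>?I. r i ^ m i)" for r :: "'a \<Rightarrow> complex poly"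
      by (rule prod.mono_neutral_right) auto
    have "pure_parts n2 n1 (p i + q i) (p i) (q i)" for i
      using supported_in_pcompose_monom[OF 2(1) 1(3)] supported_in_pcompose_monom[OF 1(1) 2(3)]
      by (simp add: pure_parts_def p_def q_def supported_in_def)
    then have "pure_parts n2 n1 (\<Prod>i\<in>?I. (p i + q i) ^ m i) (\<Prod>i\<in>?I. p i ^ m i) (\<Prod>i\<in>?I. q i ^ m i)"
      using False by (intro pure_parts_prod pure_parts_power) auto
    then have "supported_in {n2 * i + n1 * j | i j. i > 0 \<and> j > 0}
        ((\<Prod>i\<in>UNIV. (p i + q i) ^ m i) - (\<Prod>i\<in>UNIV. p i ^ m i) - (\<Prod>i\<in>UNIV. q i ^ m i))"
      unfolding red pure_parts_def by simp
    moreover have "n1 * n2 \<notin> {n2 * i + n1 * j | i j. i > 0 \<and> j > 0}"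
    proof
      assume "n1 * n2 \<in> {n2 * i + n1 * j | i j. i > 0 \<and> j > 0}"
      then obtain i j where ij: "n1 * n2 = n2 * i + n1 * j" "i > 0" "j > 0" by auto
      have "n1 dvd n2 * i + n1 * j" by (simp add: ij(1)[symmetric])
      then have "n1 dvd n2 * i" by (simp only: dvd_add_left_iff dvd_triv_left)
      moreover have "coprime n1 n2" using 2(2) by (simp add: coprime_commute)
      ultimately have "n1 dvd i" by (simp add: coprime_dvd_mult_right_iff)
      then have "n1 * n2 \<le> n2 * i" using ij(2) by (simp add: dvd_imp_le mult.commute)
      with ij 1(1) show False by simp
    qed
    ultimately have "coeff (\<Prod>i\<in>UNIV. (p i + q i) ^ m i) (n1 * n2) =
        coeff (\<Prod>i\<in>UNIV. p i ^ m i) (n1 * n2) + coeff (\<Prod>i\<in>UNIV. q i ^ m i) (n1 * n2)"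
      unfolding supported_in_def by (fastforce simp: algebra_simps)
    moreover have "(\<Prod>i\<in>UNIV. p i ^ m i) = pcompose (\<Prod>i\<in>UNIV. \<psi>1 i ^ m i) (monom 1 n2)"
      and "(\<Prod>i\<in>UNIV. q i ^ m i) = pcompose (\<Prod>i\<in>UNIV. \<psi>2 i ^ m i) (monom 1 n1)"
      by (simp_all add: p_def q_def pcompose_prod pcompose_power)
    ultimately show ?thesis using 1 2 by (simp add: coeff_pcompose_monom)
  qed
  show "\<exists>n>0. \<exists>\<psi>. coprime n M \<and> (\<forall>i. coeff (\<psi> i) 0 = 0) \<and>
      (\<forall>m. coeff (\<Prod>i\<in>UNIV. \<psi> i ^ m i) n = c m + d m)"
    using 1(1,2) 2(1,2) eq p0 q0
    by (intro exI[of _ "n1 * n2"] conjI exI[of _ "\<lambda>i. p i + q i"] allI) simp_all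
qed

lemma curve_functional_zero: "curve_functional (\<lambda>m :: 'd::finite \<Rightarrow> nat. 0)"
  unfolding curve_functional_def
proof (intro allI impI)
  fix M :: nat
  have "coeff (\<Prod>i\<in>UNIV. (0 :: complex poly) ^ m i) 1 = 0" for m :: "'d \<Rightarrow> nat"
  proof (cases "\<forall>i. m i = 0")
    case False
    then have "(\<Prod>i\<in>UNIV. (0 :: complex poly) ^ m i) = 0" by auto
    then show ?thesis by (simp only: coeff_0)
  qed simp
  then show "\<exists>n>0. \<exists>\<psi>. coprime n M \<and> (\<forall>i. coeff (\<psi> i) 0 = 0) \<and>
      (\<forall>m::'d \<Rightarrow> nat. coeff (\<Prod>i\<in>UNIV. \<psi> i ^ m i :: complex poly) n = 0)"
    by (intro exI[of _ 1] conjI exI[of _ "\<lambda>i. 0"] allI) simp_all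
qed

lemma curve_functional_coordinate:
  fixes j :: "'d::finite"
  shows "curve_functional (\<lambda>m. if m = (\<lambda>i. 0)(j := 1) then x else 0)"
  unfolding curve_functional_def
proof (intro allI impI)
  fix M :: nat
  let ?psi = "\<lambda>i. if i = j then monom x 1 else 0"
  have "coeff (\<Prod>i\<in>UNIV. ?psi i ^ m i) 1 = (if m = (\<lambda>i. 0)(j := 1) then x else 0)" for m
  proof (cases "\<exists>i. i \<noteq> j \<and> m i > 0")
    case True
    then obtain i where "i \<noteq> j" "m i > 0" by auto
    then have "?psi i ^ m i = 0" by simp
    then have "(\<Prod>i\<in>UNIV. ?psi i ^ m i) = 0" by (intro prod_zero bexI[of _ i]) simp_all
    moreover have "m \<noteq> (\<lambda>i. 0)(j := 1)" using True by auto
    ultimately show ?thesis by (simp only: coeff_0 if_False)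
  next
    case False
    then have "(\<Prod>i\<in>UNIV. ?psi i ^ m i) = (\<Prod>i\<in>{j}. ?psi i ^ m i)"
      by (intro prod.mono_neutral_right) auto
    moreover have "m = (\<lambda>i. 0)(j := 1) \<longleftrightarrow> m j = 1" using False by (auto simp: fun_eq_iff)
    ultimately show ?thesis by (auto simp: monom_power)
  qed
  then show "\<exists>n>0. \<exists>\<psi>. coprime n M \<and> (\<forall>i. coeff (\<psi> i) 0 = 0) \<and>
      (\<forall>m. coeff (\<Prod>i\<in>UNIV. \<psi> i ^ m i) n = (if m = (\<lambda>i. 0)(j := 1) then x else 0))"
    by (intro exI[of _ 1] conjI exI[of _ ?psi] allI) simp_all
qed

text \<open>
  Passing from the dual monomial with exponents \<open>k\<close> to the one with an additional variable \<open>j\<close>: add a new term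
  \<open>t\<^sup>b\<close> to the \<open>j\<close>-th coordinate of the curve reparametrized by \<open>t\<^sup>a\<close>, and choose \<open>a\<close>, \<open>b\<close> and the
  new index so that only terms linear in \<open>t\<^sup>b\<close> are counted. The factor \<open>Suc (k j)\<close> is the number of ways to pick
  the linear term.
\<close>

lemma curve_functional_step:
  assumes "curve_functional (\<lambda>m. if m = k then x / of_nat (Suc (k j)) else 0)"
  shows "curve_functional (\<lambda>m. if m = k(j := Suc (k j)) then x else 0)"
  unfolding curve_functional_def
proof (intro allI impI)
  fix M :: nat assume M: "M > 0"
  have "\<exists>n>0. \<exists>\<psi>. (\<forall>i. coeff (\<psi> i) 0 = 0) \<and>
      (\<forall>m. coeff (\<Prod>i\<in>UNIV. \<psi> i ^ m i) n = (if m = k then x / of_nat (Suc (k j)) else 0))"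
    using assms[unfolded curve_functional_def, rule_format, of 1] by (meson zero_less_one)
  then obtain n1 \<psi> where 1: "n1 > 0" "\<And>i. coeff (\<psi> i) 0 = 0"
      "\<And>m. coeff (\<Prod>i\<in>UNIV. \<psi> i ^ m i) n1 = (if m = k then x / of_nat (Suc (k j)) else 0)"
    by metis
  \<comment> \<open>\<open>a > 1\<close> and \<open>b \<equiv> 1\<close> modulo \<open>a\<close> force \<open>r \<equiv> 1\<close> in \<open>a i + b r = n\<close>, and \<open>b > n1\<close> makes \<open>r > 1\<close> too large.
    Moreover \<open>n \<equiv> 1\<close> modulo \<open>M\<close>, since \<open>M\<close> divides \<open>a\<close>.\<close>
  define a where "a = 2 * M"
  define b where "b = 1 + a * n1"
  define n where "n = n1 * a + b"
  have a: "a > 1" and n: "n > 0" using M by (auto simp: a_def b_def n_def)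
  have "1 * n1 \<le> a * n1" using a by (intro mult_right_mono) auto
  then have b: "b > n1" unfolding b_def by linarith
  have cop: "coprime n M"
  proof (rule coprimeI)
    fix d assume d: "d dvd n" "d dvd M"
    have "n = M * (4 * n1) + 1" by (simp add: n_def b_def a_def)
    with d show "is_unit d" by (metis dvd_add_right_iff dvd_mult2)
  qed
  have uniq: "r = 1 \<and> i = n1" if eq: "a * i + b * r = n" for i r
  proof -
    have "r = 1"
    proof (rule ccontr)
      assume "r \<noteq> 1"
      have "a * (i + n1 * r) + r = a * (2 * n1) + 1"
        using eq by (simp add: n_def b_def algebra_simps)
      then have "(a * (i + n1 * r) + r) mod a = (a * (2 * n1) + 1) mod a" by simp
      moreover have "(a * (2 * n1) + 1) mod a = 1" using a by (simp only: mod_mult_self4 mod_less)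
      moreover have "(a * (i + n1 * r) + r) mod a = r mod a" by (simp only: mod_mult_self4)
      ultimately have mod: "r mod a = 1" by (simp only:)
      have "r \<noteq> 0" using mod a by (metis mod_0 zero_neq_one)
      then have "r \<ge> a" using mod \<open>r \<noteq> 1\<close> by (metis mod_less not_le)
      then have "r \<ge> a + 1" using mod a by (cases "r = a") auto
      then have "b * (a + 1) \<le> b * r" by (rule mult_le_mono2)
      then have "b * a + b \<le> n1 * a + b" using eq unfolding n_def distrib_left mult_1_right by linarith
      then have "b * a \<le> n1 * a" by simp
      with a b show False by simp
    qed
    with eq a show ?thesis by (simp add: n_def)
  qed
  define P where "P i = pcompose (\<psi> i) (monom 1 a)" for i
  define \<phi> where "\<phi> i = (if i = j then P i + monom 1 b else P i)" for i
  have \<phi>0: "coeff (\<phi> i) 0 = 0" for i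
    using 1(2) a by (auto simp: \<phi>_def P_def poly_0_coeff_0 b_def)
  have "coeff (\<Prod>i\<in>UNIV. \<phi> i ^ m i) n = (if m = k(j := Suc (k j)) then x else 0)" for m
  proof -
    have "(\<Prod>i\<in>UNIV. \<phi> i ^ m i) = \<phi> j ^ m j * (\<Prod>i\<in>UNIV - {j}. \<phi> i ^ m i)"
      by (simp add: prod.remove)
    also have "(\<Prod>i\<in>UNIV - {j}. \<phi> i ^ m i) = (\<Prod>i\<in>UNIV - {j}. P i ^ m i)"
      by (intro prod.cong) (auto simp: \<phi>_def)
    also have "\<phi> j ^ m j = (\<Sum>r\<le>m j. of_nat (m j choose r) * monom 1 b ^ r * P j ^ (m j - r))"
      by (simp add: \<phi>_def add.commute[of "P j"] binomial_ring)
    also have "\<dots> * (\<Prod>i\<in>UNIV - {j}. P i ^ m i) =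
        (\<Sum>r\<le>m j. of_nat (m j choose r) * (monom 1 (b * r) *
          (P j ^ (m j - r) * (\<Prod>i\<in>UNIV - {j}. P i ^ m i))))"
      by (simp add: sum_distrib_right monom_power mult.assoc)
    also have "\<dots> = (\<Sum>r\<le>m j. of_nat (m j choose r) * (monom 1 (b * r) *
          (\<Prod>i\<in>UNIV. P i ^ ((m(j := m j - r)) i))))"
      by (intro sum.cong refl arg_cong2[where f = "(*)"]) (simp add: prod.remove[of UNIV j])
    finally have *: "(\<Prod>i\<in>UNIV. \<phi> i ^ m i) = (\<Sum>r\<le>m j. of_nat (m j choose r) * (monom 1 (b * r) *
          (\<Prod>i\<in>UNIV. P i ^ ((m(j := m j - r)) i))))" .
    have Ppow: "(\<Prod>i\<in>UNIV. P i ^ l i) = pcompose (\<Prod>i\<in>UNIV. \<psi> i ^ l i) (monom 1 a)" for l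
      by (simp add: P_def pcompose_prod pcompose_power)
    have summand: "coeff (monom 1 (b * r) * (\<Prod>i\<in>UNIV. P i ^ l i)) n =
        (if r = 1 \<and> l = k then x / of_nat (Suc (k j)) else 0)" for r l
    proof -
      have "coeff (monom 1 (b * r) * (\<Prod>i\<in>UNIV. P i ^ l i)) n =
          (if b * r \<le> n \<and> a dvd n - b * r then coeff (\<Prod>i\<in>UNIV. \<psi> i ^ l i) ((n - b * r) div a) else 0)"
        using a by (auto simp: coeff_monom_mult Ppow coeff_pcompose_monom)
      also have "\<dots> = (if r = 1 then coeff (\<Prod>i\<in>UNIV. \<psi> i ^ l i) n1 else 0)"
      proof (cases "b * r \<le> n \<and> a dvd n - b * r")
        case True
        then have "a * ((n - b * r) div a) + b * r = n" by simp
        from uniq[OF this] have "r = 1" and q: "(n - b * r) div a = n1" by blast+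
        then show ?thesis unfolding q using True by (simp only: if_True simp_thms)
      next
        case False
        then have "r \<noteq> 1" using a by (auto simp: n_def)
        with False show ?thesis by auto
      qed
      finally show ?thesis by (simp add: 1(3))
    qed
    have scale: "coeff (of_nat N * p) n = of_nat N * coeff p n" for N and p :: "complex poly"
      by (simp add: of_nat_poly)
    have "coeff (\<Prod>i\<in>UNIV. \<phi> i ^ m i) n = (\<Sum>r\<le>m j. of_nat (m j choose r) *
        (if r = 1 \<and> m(j := m j - r) = k then x / of_nat (Suc (k j)) else 0))"
      unfolding * coeff_sum scale summand ..
    also have "\<dots> = (\<Sum>r\<in>{..m j} \<inter> {1}. of_nat (m j choose r) *
        (if r = 1 \<and> m(j := m j - r) = k then x / of_nat (Suc (k j)) else 0))"
      by (intro sum.mono_neutral_right) auto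
    also have "\<dots> = (if m j \<ge> 1 \<and> m(j := m j - 1) = k then of_nat (m j) * (x / of_nat (Suc (k j))) else 0)"
      by (auto simp: Int_insert_right)
    also have "\<dots> = (if m = k(j := Suc (k j)) then x else 0)"
    proof -
      have "m j \<ge> 1 \<and> m(j := m j - 1) = k \<longleftrightarrow> m = k(j := Suc (k j))"
        by (auto simp: fun_eq_iff)
      then show ?thesis by (auto simp del: of_nat_Suc)
    qed
    finally show ?thesis .
  qed
  then show "\<exists>n>0. \<exists>\<psi>. coprime n M \<and> (\<forall>i. coeff (\<psi> i) 0 = 0) \<and>
      (\<forall>m. coeff (\<Prod>i\<in>UNIV. \<psi> i ^ m i) n = (if m = k(j := Suc (k j)) then x else 0))"
    using n cop \<phi>0 by blast
qed

lemma curve_functional_single: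
  assumes "k \<noteq> (\<lambda>i. 0)"
  shows "curve_functional (\<lambda>m. if m = k then x else 0)"
  using assms
proof (induction "\<Sum>i\<in>UNIV. k i" arbitrary: k x)
  case 0
  then show ?case by auto
next
  case (Suc s)
  then obtain j where j: "k j > 0" by (auto simp: fun_eq_iff)
  define l where "l = k(j := k j - 1)"
  have k: "k = l(j := Suc (l j))" using j by (auto simp: l_def)
  show ?case
  proof (cases "l = (\<lambda>i. 0)")
    case True
    then show ?thesis using curve_functional_coordinate[of j x] k by simp
  next
    case False
    have "(\<Sum>i\<in>UNIV. k i) = Suc (\<Sum>i\<in>UNIV. l i)"
      unfolding k by (simp add: sum.remove[of UNIV j])
    then have "curve_functional (\<lambda>m. if m = l then x / of_nat (Suc (l j)) else 0)"
      using Suc False by auto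
    then show ?thesis by (subst k) (rule curve_functional_step)
  qed
qed

text \<open>
  The zero exponent has to be excluded, because the constant term of a polynomial contributes nothing to a
  coefficient of positive index.
\<close>

lemma curve_functional_finite_support:
  assumes "finite {k. c k \<noteq> 0}" "c (\<lambda>i. 0) = 0"
  shows "curve_functional c"
proof -
  have "curve_functional (\<lambda>m. \<Sum>k\<in>F. if m = k then c k else 0)"
    if "finite F" "F \<subseteq> {k. c k \<noteq> 0}" for F
    using that
  proof (induction F)
    case (insert k F)
    then have "curve_functional (\<lambda>m. (if m = k then c k else 0) + (\<Sum>k\<in>F. if m = k then c k else 0))"
      using assms(2) by (intro curve_functional_add curve_functional_single) auto
    with insert show ?case by (simp del: sum.delta sum.delta')
  qed (simp add: curve_functional_zero)
  from this[OF assms(1)] show ?thesis using assms(1)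
    by (auto simp: sum.delta' cong: if_cong elim!: back_subst[of curve_functional])
qed

section \<open>Polynomial functions and Taylor monomials\<close>

definition shifted_monomial :: "complex ^ 'd::finite \<Rightarrow> ('d \<Rightarrow> nat) \<Rightarrow> complex ^ 'd \<Rightarrow> complex" where
  "shifted_monomial c k = (\<lambda>z. \<Prod>i\<in>UNIV. (z $ i - c $ i) ^ k i)"

definition polynomial_functions :: "(complex ^ 'd::finite \<Rightarrow> complex) set" where
  "polynomial_functions = cfun.span (range monomial_fun)"

lemma fscale_apply: "fscale a f x = a * f x"
  by (simp add: fscale_def)

lemma sum_fun_apply: "sum f A x = (\<Sum>a\<in>A. f a x)" for f :: "'a \<Rightarrow> 'b \<Rightarrow> complex"
  by (induction A rule: infinite_finite_induct) auto

lemma mult_fscale: "p * fscale a q = fscale a (p * q)" "fscale a p * q = fscale a (p * q)"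
  by (auto simp: fun_eq_iff fscale_apply)

lemma span_closure_induct [consumes 1, case_names zero add scale base]:
  assumes "p \<in> cfun.span S"
    and "P 0" "\<And>p q. P p \<Longrightarrow> P q \<Longrightarrow> P (p + q)" "\<And>a p. P p \<Longrightarrow> P (fscale a p)"
    and "\<And>p. p \<in> S \<Longrightarrow> P p"
  shows "P p"
proof -
  have "cfun.subspace (Collect P)" unfolding cfun.subspace_def mem_Collect_eq using assms(2-4) by blast
  with assms(1) show ?thesis by (rule cfun.span_induct) (rule assms(5))
qed

lemma span_mult_closed:
  assumes S: "\<And>p q. p \<in> S \<Longrightarrow> q \<in> S \<Longrightarrow> p * q \<in> cfun.span S"
    and "p \<in> cfun.span S" "q \<in> cfun.span S"
  shows "p * q \<in> cfun.span S"
proof -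
  have left: "p * q \<in> cfun.span S" if "p \<in> cfun.span S" "q \<in> S" for p q
    using that(1)
    by (induction rule: span_closure_induct)
      (simp_all only: mult_zero_left distrib_right mult_fscale cfun.span_add cfun.span_scale cfun.span_zero S that(2))
  from assms(3) show ?thesis
    by (induction rule: span_closure_induct)
      (simp_all only: mult_zero_right distrib_left mult_fscale cfun.span_add cfun.span_scale cfun.span_zero left assms(2))
qed

lemma monomial_fun_eq_shifted: "monomial_fun = shifted_monomial 0"
  by (simp add: fun_eq_iff monomial_fun_def shifted_monomial_def)

lemma shifted_monomial_mult:
  "shifted_monomial c k * shifted_monomial c l = shifted_monomial c (\<lambda>i. k i + l i)"
  by (simp add: fun_eq_iff shifted_monomial_def power_add prod.distrib)

lemma shifted_monomial_zero [simp]: "shifted_monomial c (\<lambda>i. 0) = 1"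
  by (simp add: fun_eq_iff shifted_monomial_def)

lemma shifted_monomial_power: "shifted_monomial c ((\<lambda>i. 0)(j := n)) z = (z $ j - c $ j) ^ n"
proof -
  have "(\<Prod>i\<in>UNIV. (z $ i - c $ i) ^ ((\<lambda>i. 0)(j := n)) i) = (\<Prod>i\<in>{j}. (z $ i - c $ i) ^ n)"
    by (rule prod.mono_neutral_cong_right) auto
  then show ?thesis by (simp add: shifted_monomial_def)
qed

lemma shifted_monomial_at_center: "k \<noteq> (\<lambda>i. 0) \<Longrightarrow> shifted_monomial c k c = 0"
  by (auto simp: shifted_monomial_def fun_eq_iff)

text \<open>
  Taylor expansion at an arbitrary point: the span of the shifted monomials is closed under products and contains
  \<open>z\<^sub>i - c\<^sub>i\<close>, since changing the centre only adds a constant to it.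
\<close>

lemma shifted_monomial_in_span: "shifted_monomial c k \<in> cfun.span (range (shifted_monomial d))"
proof -
  let ?S = "cfun.span (range (shifted_monomial d))"
  have mult: "p * q \<in> ?S" if "p \<in> ?S" "q \<in> ?S" for p q
    using _ that
    by (rule span_mult_closed) (auto simp: shifted_monomial_mult intro: cfun.span_base)
  have one: "1 \<in> ?S"
    by (rule cfun.span_base) (auto intro: range_eqI[of _ _ "\<lambda>i. 0"])
  have coord: "(\<lambda>z. z $ i - c $ i) \<in> ?S" for i
  proof -
    have "(\<lambda>z. z $ i - c $ i) = shifted_monomial d ((\<lambda>i. 0)(i := 1)) + fscale (d $ i - c $ i) 1"
      unfolding fun_eq_iff plus_fun_apply shifted_monomial_power by (simp add: fscale_apply)
    then show ?thesis using one by (simp only: cfun.span_add cfun.span_scale cfun.span_base rangeI)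
  qed
  have pow: "(\<lambda>z. (z $ i - c $ i) ^ n) \<in> ?S" for i n
  proof (induction n)
    case (Suc n)
    then show ?case using mult[OF coord[of i] Suc] by (simp only: times_fun_def power_Suc)
  qed (use one in \<open>simp add: one_fun_def\<close>)
  have "(\<lambda>z. \<Prod>i\<in>A. (z $ i - c $ i) ^ k i) \<in> ?S" if "finite A" for A
    using that
  proof (induction A)
    case (insert a A)
    then show ?case
      using mult[OF pow[of a "k a"] insert.IH] by (simp only: times_fun_def prod.insert insert.hyps)
  qed (use one in \<open>simp add: one_fun_def\<close>)
  from this[of UNIV] show ?thesis by (simp add: shifted_monomial_def)
qed

lemma polynomial_functions_shifted:
  "polynomial_functions = cfun.span (range (shifted_monomial c))"
proof -
  have "cfun.span (range (shifted_monomial d)) \<subseteq> cfun.span (range (shifted_monomial d'))" for d d' :: "complex ^ 'd"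
    by (rule cfun.span_minimal) (auto intro: shifted_monomial_in_span)
  then show ?thesis unfolding polynomial_functions_def monomial_fun_eq_shifted by blast
qed

lemma shifted_monomial_polynomial: "shifted_monomial c k \<in> polynomial_functions"
  unfolding polynomial_functions_shifted[of c] by (simp add: cfun.span_base)

lemma polynomial_functions_mult:
  "p \<in> polynomial_functions \<Longrightarrow> q \<in> polynomial_functions \<Longrightarrow> p * q \<in> polynomial_functions"
  unfolding polynomial_functions_shifted[of 0]
  by (rule span_mult_closed) (auto simp: shifted_monomial_mult intro: cfun.span_base)

lemma one_polynomial: "1 \<in> polynomial_functions"
  using shifted_monomial_polynomial[of 0 "\<lambda>i. 0"] by simp

lemma polynomial_functions_add:
  "p \<in> polynomial_functions \<Longrightarrow> q \<in> polynomial_functions \<Longrightarrow> p + q \<in> polynomial_functions"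
  unfolding polynomial_functions_def by (rule cfun.span_add)

lemma polynomial_functions_scale:
  "p \<in> polynomial_functions \<Longrightarrow> fscale a p \<in> polynomial_functions"
  unfolding polynomial_functions_def by (rule cfun.span_scale)

definition coordinate_poly :: "complex poly \<Rightarrow> 'd::finite \<Rightarrow> complex ^ 'd \<Rightarrow> complex" where
  "coordinate_poly r i = (\<lambda>z. poly r (z $ i))"

lemma coordinate_poly_mult: "coordinate_poly (r * s) i = coordinate_poly r i * coordinate_poly s i"
  and coordinate_poly_add: "coordinate_poly (r + s) i = coordinate_poly r i + coordinate_poly s i"
  and coordinate_poly_smult: "coordinate_poly (smult a r) i = fscale a (coordinate_poly r i)"
  and coordinate_poly_zero: "coordinate_poly 0 i = 0"
  and coordinate_poly_one: "coordinate_poly 1 i = 1"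
  by (simp_all add: coordinate_poly_def fun_eq_iff fscale_apply)

lemma coordinate_poly_polynomial: "coordinate_poly r i \<in> polynomial_functions"
proof (induction r)
  case 0
  show ?case unfolding coordinate_poly_zero by (simp only: polynomial_functions_def cfun.span_zero)
next
  case (pCons a r)
  have "coordinate_poly (pCons a r) i =
      fscale a 1 + shifted_monomial 0 ((\<lambda>i. 0)(i := 1)) * coordinate_poly r i"
    unfolding fun_eq_iff plus_fun_apply times_fun_apply shifted_monomial_power
    by (simp add: coordinate_poly_def fscale_apply)
  then show ?case
    by (simp only:) (intro polynomial_functions_add polynomial_functions_mult polynomial_functions_scale
        pCons.IH one_polynomial shifted_monomial_polynomial)
qed

section \<open>Functions on the hypergroup as a module over the polynomials\<close>

context polynomial_hypergroup
begin

lemma polys_upto_mono: "m \<le> n \<Longrightarrow> polys_upto m \<subseteq> polys_upto n"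
  unfolding polys_upto_def by (rule cfun.span_mono) auto

lemma inj_Q: "inj Q"
proof (rule injI)
  fix x y assume eq: "Q x = Q y"
  obtain n where "Q x \<in> polys_upto n" using polynomial by blast
  with eq basis(1)[of n] show "x = y" by (auto simp: inj_on_def)
qed

text \<open>
  Bounding the degree exhausts the family by a chain of independent sets.
\<close>

lemma independent_Q: "cfun.independent (range Q)"
proof -
  have "range Q = (\<Union>n. Q ` {x. Q x \<in> polys_upto n})" using polynomial by fast
  moreover have "cfun.independent (\<Union>n. Q ` {x. Q x \<in> polys_upto n})"
  proof (rule cfun.independent_Union_directed)
    fix c d assume "c \<in> range (\<lambda>n. Q ` {x. Q x \<in> polys_upto n})" "d \<in> range (\<lambda>n. Q ` {x. Q x \<in> polys_upto n})"
    then obtain m n where "c = Q ` {x. Q x \<in> polys_upto m}" "d = Q ` {x. Q x \<in> polys_upto n}" by auto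
    then show "c \<subseteq> d \<or> d \<subseteq> c"
      using polys_upto_mono[of m n] polys_upto_mono[of n m] nle_le[of m n] by blast
  qed (use basis(2) in auto)
  ultimately show ?thesis by simp
qed

lemma span_Q: "cfun.span (range Q) = polynomial_functions"
proof
  have "Q x \<in> polynomial_functions" for x
  proof -
    obtain n where "Q x \<in> polys_upto n" using polynomial by blast
    moreover have "polys_upto n \<subseteq> (polynomial_functions :: (complex ^ 'd \<Rightarrow> complex) set)"
      unfolding polys_upto_def polynomial_functions_def by (rule cfun.span_mono) auto
    ultimately show ?thesis by (rule rev_subsetD)
  qed
  then show "cfun.span (range Q) \<subseteq> polynomial_functions"
    unfolding polynomial_functions_def by (intro cfun.span_minimal cfun.subspace_span image_subsetI)
  have "monomial_fun k \<in> cfun.span (range Q)" for k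
  proof -
    have "monomial_fun k \<in> polys_upto (\<Sum>i\<in>UNIV. k i)"
      unfolding polys_upto_def by (rule cfun.span_base) auto
    then have "monomial_fun k \<in> cfun.span (Q ` {x. Q x \<in> polys_upto (\<Sum>i\<in>UNIV. k i)})"
      unfolding basis(3) .
    then show ?thesis by (rule rev_subsetD[OF _ cfun.span_mono]) (rule image_mono, rule subset_UNIV)
  qed
  then show "polynomial_functions \<subseteq> cfun.span (range Q)"
    unfolding polynomial_functions_def by (intro cfun.span_minimal cfun.subspace_span image_subsetI)
qed

lemma Q_polynomial: "Q x \<in> polynomial_functions"
  unfolding span_Q[symmetric] by (simp add: cfun.span_base)

text \<open>
  The linear functional on polynomials with \<open>Q x \<mapsto> h x\<close>. Outside the polynomials its values depend on an
  arbitrary extension of the basis, so it is determined by \<open>h\<close> only on \<open>polynomial_functions\<close>.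
\<close>

definition functional :: "('x \<Rightarrow> complex) \<Rightarrow> (complex ^ 'd \<Rightarrow> complex) \<Rightarrow> complex" where
  "functional h = vector_space_pair.construct fscale (*) (range Q) (\<lambda>q. h (inv Q q))"

lemma functional_Q: "functional h (Q x) = h x"
  and functional_add: "functional h (p + q) = functional h p + functional h q"
  and functional_scale: "functional h (fscale a p) = a * functional h p"
proof -
  interpret pair: vector_space_pair "fscale :: complex \<Rightarrow> (complex ^ 'd \<Rightarrow> complex) \<Rightarrow> _"
      "(*) :: complex \<Rightarrow> complex \<Rightarrow> complex"
    by unfold_locales (simp_all add: distrib_left distrib_right)
  show "functional h (Q x) = h x"
    unfolding functional_def pair.construct_basis[OF independent_Q rangeI] inv_f_f[OF inj_Q] ..
  interpret lin: Vector_Spaces.linear fscale "(*)" "functional h"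
    unfolding functional_def by (rule pair.linear_construct[OF independent_Q])
  show "functional h (p + q) = functional h p + functional h q" by (rule lin.add)
  show "functional h (fscale a p) = a * functional h p" by (rule lin.scale)
qed

lemma functional_zero: "functional h 0 = 0"
  using functional_scale[of h 0 0] by (simp add: fscale_def zero_fun_def)

lemma functional_sum: "functional h (sum p A) = (\<Sum>a\<in>A. functional h (p a))"
  by (induction A rule: infinite_finite_induct)
    (simp_all only: simp_thms sum.infinite sum.empty sum.insert functional_zero functional_add)

lemma functional_unique:
  assumes "p \<in> polynomial_functions"
    and add: "\<And>p q. L (p + q) = L p + L q" and scale: "\<And>a p. L (fscale a p) = a * L p"
    and Q: "\<And>x. L (Q x) = h x"
  shows "functional h p = L p"
  using assms(1) unfolding span_Q[symmetric]
proof (induction rule: span_closure_induct)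
  case zero
  have "L 0 = 0" using scale[of 0 0] by (simp add: fscale_def zero_fun_def)
  then show ?case by (simp only: functional_zero)
next
  case (base q)
  then obtain x where "q = Q x" by blast
  then show ?case by (simp only: functional_Q Q)
qed (simp_all only: functional_add functional_scale add scale)

text \<open>
  The module structure dual to multiplication: \<open>act p\<close> is the transpose of multiplication by \<open>p\<close>, see
  \<open>functional_act\<close>. For \<open>p = Q y\<close> it is translation by \<open>y\<close>, see \<open>act_Q\<close>.
\<close>

definition act :: "(complex ^ 'd \<Rightarrow> complex) \<Rightarrow> ('x \<Rightarrow> complex) \<Rightarrow> 'x \<Rightarrow> complex" where
  "act p h = (\<lambda>x. functional h (p * Q x))"

lemma functional_act:
  "q \<in> polynomial_functions \<Longrightarrow> functional (act p h) q = functional h (p * q)"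
  by (rule functional_unique)
    (simp_all only: act_def distrib_left functional_add mult_fscale functional_scale)

lemma act_act:
  assumes "p \<in> polynomial_functions"
  shows "act p (act q h) = act (p * q) h"
proof
  fix x
  have "act p (act q h) x = functional h (q * (p * Q x))"
    unfolding act_def[of p] by (rule functional_act) (intro polynomial_functions_mult assms Q_polynomial)
  also have "q * (p * Q x) = p * q * Q x" by (simp only: mult_ac)
  finally show "act p (act q h) x = act (p * q) h x" by (simp only: act_def)
qed

lemma act_add: "act (p + q) h = act p h + act q h"
  and act_scale: "act (fscale a p) h = fscale a (act p h)"
  and act_one: "act 1 h = h"
  by (simp_all add: fun_eq_iff fscale_apply act_def distrib_right mult_fscale functional_add functional_scale functional_Q)

lemma act_zero_left: "act 0 h = 0"
  using act_scale[of 0 0 h] by (simp add: fscale_def zero_fun_def)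

lemma act_zero:
  assumes "p \<in> polynomial_functions"
  shows "act p 0 = 0"
proof
  fix x
  show "act p 0 x = 0 x"
    unfolding act_def zero_fun_apply
    by (rule functional_unique[OF polynomial_functions_mult[OF assms Q_polynomial]]) simp_all
qed

lemma act_Q: "act (Q y) h = translate conv y h"
proof
  fix x
  have "Q y * Q x = (\<Sum>w\<in>set_pmf (conv x y). fscale (pmf (conv x y) w) (Q w))"
    using linearization[of x _ y] by (simp add: fun_eq_iff sum_fun_apply fscale_apply mult.commute)
  then have "act (Q y) h x = (\<Sum>w\<in>set_pmf (conv x y). complex_of_real (pmf (conv x y) w) * h w)"
    by (simp add: act_def functional_sum functional_scale functional_Q)
  also have "\<dots> = translate conv y h x"
    unfolding translate_def conv_eval_def
    by (subst integral_measure_pmf[OF finite_supp]) (auto simp: scaleR_conv_of_real)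
  finally show "act (Q y) h x = translate conv y h x" .
qed

lemma act_in_variety:
  assumes V: "variety conv V" and "h \<in> V" "p \<in> polynomial_functions"
  shows "act p h \<in> V"
proof -
  have sub: "cfun.subspace V" using V by (simp add: variety_def)
  show ?thesis using assms(3) unfolding span_Q[symmetric]
  proof (induction rule: span_closure_induct)
    case zero
    show ?case unfolding act_zero_left by (rule cfun.subspace_0[OF sub])
  next
    case (add p q)
    then show ?case unfolding act_add by (rule cfun.subspace_add[OF sub])
  next
    case (scale a p)
    then show ?case unfolding act_scale by (rule cfun.subspace_scale[OF sub])
  next
    case (base q)
    then obtain y where "q = Q y" by blast
    then show ?case using V assms(2) by (simp only: act_Q variety_def)
  qed
qed


lemma functional_eq_act: "functional h p = act p h e"
  by (simp only: act_def Q_identity one_fun_def[symmetric] mult_1_right)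

section \<open>Primary decomposition\<close>

lemma act_commute:
  assumes "p \<in> polynomial_functions" "q \<in> polynomial_functions"
  shows "act p (act q h) = act q (act p h)"
  by (simp only: act_act assms mult.commute)

lemma act_coordinate_mult:
  "act (coordinate_poly r i) (act (coordinate_poly s i) h) = act (coordinate_poly (r * s) i) h"
  by (simp only: act_act coordinate_poly_polynomial coordinate_poly_mult)

text \<open>
  Split off one root \<open>\<mu>\<close> of \<open>\<eta>\<close> with its full multiplicity \<open>n\<close>, so that the cofactor \<open>\<rho>\<close> is coprime to
  \<open>l\<^sup>n\<close> for \<open>l = z - \<mu>\<close>. By \<open>a l\<^sup>n + b \<rho> = 1\<close>, \<open>g\<close> is the sum of a part killed by \<open>\<rho>\<close>, to which
  the induction applies, and a part killed by \<open>l\<^sup>n\<close>. All parts are multiples of \<open>g\<close>, which keeps them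
  in every variety that contains \<open>g\<close> and keeps equations in other coordinates valid.
\<close>

lemma primary_decomposition_coordinate:
  assumes "\<eta> \<noteq> 0" "act (coordinate_poly \<eta> i) g = 0"
  shows "g \<in> cfun.span {act (coordinate_poly r i) g | r.
           \<exists>\<mu> n. act (coordinate_poly ([:-\<mu>, 1:] ^ n) i) (act (coordinate_poly r i) g) = 0}"
  using assms
proof (induction "degree \<eta>" arbitrary: \<eta> g rule: less_induct)
  case less
  show ?case
  proof (cases "degree \<eta> = 0")
    case True
    then obtain a where a: "\<eta> = [:a:]" by (rule degree_eq_zeroE)
    with less.prems have "a \<noteq> 0" by auto
    have "\<eta> = smult a 1" using a by simp
    then have "fscale a g = 0"
      using less.prems(2) by (simp only: coordinate_poly_smult act_scale coordinate_poly_one act_one)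
    then have "g = 0" using \<open>a \<noteq> 0\<close> by (simp only: cfun.scale_eq_0_iff) simp
    then show ?thesis by (simp only: cfun.span_zero)
  next
    case False
    then obtain \<mu> where "poly \<eta> \<mu> = 0"
      using alg_closed_imp_poly_has_root[of \<eta>] by auto
    define l where "l = [:-\<mu>, 1:]"
    define n where "n = order \<mu> \<eta>"
    obtain \<rho> where \<rho>: "\<eta> = l ^ n * \<rho>" "\<not> l dvd \<rho>"
      using order_decomp[OF less.prems(1), of \<mu>] unfolding l_def n_def by blast
    have "n > 0" using \<open>poly \<eta> \<mu> = 0\<close> less.prems(1) by (simp add: n_def order_root)
    have "\<rho> \<noteq> 0" using \<rho> less.prems(1) by auto
    have "degree \<eta> = n + degree \<rho>"
      using \<rho>(1) \<open>\<rho> \<noteq> 0\<close> by (simp add: degree_mult_eq degree_linear_power l_def)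
    then have deg: "degree \<rho> < degree \<eta>" using \<open>n > 0\<close> by simp
    have "coprime l \<rho>"
    proof (rule prime_elem_imp_coprime)
      show "prime_elem l" unfolding l_def by (rule prime_elem_linear_field_poly) simp
    qed (rule \<rho>(2))
    then have "coprime (l ^ n) \<rho>" by simp
    then obtain a b where ab: "a * l ^ n + b * \<rho> = 1"
      using bezout_coefficients_fst_snd[of "l ^ n" \<rho>] by (auto simp: coprime_iff_gcd_eq_1)
    let ?S = "\<lambda>g. {act (coordinate_poly r i) g | r.
           \<exists>\<mu> n. act (coordinate_poly ([:-\<mu>, 1:] ^ n) i) (act (coordinate_poly r i) g) = 0}"
    define g1 where "g1 = act (coordinate_poly (a * l ^ n) i) g"
    define g2 where "g2 = act (coordinate_poly (b * \<rho>) i) g"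
    have "act (coordinate_poly (a * l ^ n + b * \<rho>) i) g = g"
      by (simp only: ab coordinate_poly_one act_one)
    then have g: "g = g1 + g2"
      by (simp only: coordinate_poly_add act_add g1_def g2_def)
    have kill: "act (coordinate_poly (r * \<eta>) i) g = 0" for r
      unfolding act_coordinate_mult[symmetric] less.prems(2)
      by (rule act_zero) (rule coordinate_poly_polynomial)
    have "l ^ n * (b * \<rho>) = b * \<eta>" using \<rho>(1) by (simp add: mult_ac)
    then have "act (coordinate_poly (l ^ n) i) g2 = 0"
      unfolding g2_def act_coordinate_mult by (simp only: kill)
    then have "g2 \<in> ?S g" unfolding g2_def l_def by blast
    moreover have "g1 \<in> cfun.span (?S g)"
    proof -
      have "\<rho> * (a * l ^ n) = a * \<eta>" using \<rho>(1) by (simp add: mult_ac)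
      then have "act (coordinate_poly \<rho> i) g1 = 0"
        unfolding g1_def act_coordinate_mult by (simp only: kill)
      then have "g1 \<in> cfun.span (?S g1)" using less.hyps[OF deg \<open>\<rho> \<noteq> 0\<close>] by blast
      moreover have "?S g1 \<subseteq> ?S g"
      proof
        fix h assume "h \<in> ?S g1"
        then obtain r \<nu> m where h: "h = act (coordinate_poly r i) g1"
          "act (coordinate_poly ([:-\<nu>, 1:] ^ m) i) h = 0" by blast
        have "h = act (coordinate_poly (r * (a * l ^ n)) i) g"
          unfolding h(1) g1_def act_coordinate_mult ..
        with h(2) show "h \<in> ?S g" by blast
      qed
      ultimately show ?thesis using cfun.span_mono by blast
    qed
    ultimately have "g1 + g2 \<in> cfun.span (?S g)" by (intro cfun.span_add cfun.span_base[of g2])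
    then show ?thesis unfolding g[symmetric] .
  qed
qed

text \<open>
  The multiples of \<open>g\<close> by more powers of a coordinate than the dimension of \<open>V\<close> are linearly dependent; a linear
  relation between them is a polynomial equation.
\<close>

lemma ex_annihilating_coordinate_poly:
  assumes V: "variety conv V" and fin: "finite B" "cfun.span B = V" and "g \<in> V"
  shows "\<exists>\<eta>. \<eta> \<noteq> 0 \<and> act (coordinate_poly \<eta> i) g = 0"
proof -
  define v where "v k = act (coordinate_poly (monom 1 k) i) g" for k
  have v: "v k \<in> cfun.span B" for k
    unfolding fin(2) v_def by (rule act_in_variety[OF V \<open>g \<in> V\<close> coordinate_poly_polynomial])
  have act_comb: "act (coordinate_poly (\<Sum>k\<in>A. smult (u k) (monom 1 k)) i) g = (\<Sum>k\<in>A. fscale (u k) (v k))" for u A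
    by (induction A rule: infinite_finite_induct)
      (simp_all only: simp_thms sum.infinite sum.empty sum.insert coordinate_poly_zero coordinate_poly_add
        coordinate_poly_smult act_zero_left act_add act_scale v_def)
  let ?A = "{..card B}"
  show ?thesis
  proof (cases "inj_on v ?A")
    case True
    then have "card (v ` ?A) = Suc (card B)" by (simp add: card_image)
    then have "cfun.dependent (v ` ?A)"
      using cfun.independent_span_bound[OF fin(1) _ image_subsetI[of ?A v, OF v]] by auto
    then obtain u k where u: "k \<in> ?A" "u (v k) \<noteq> 0" "(\<Sum>w\<in>v ` ?A. fscale (u w) w) = 0"
      unfolding cfun.dependent_finite[OF finite_imageI[OF finite_atMost]] by blast
    define \<eta> where "\<eta> = (\<Sum>k\<in>?A. smult (u (v k)) (monom 1 k))"
    have "act (coordinate_poly \<eta> i) g = 0"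
      unfolding \<eta>_def act_comb using u(3) by (simp only: sum.reindex[OF True] comp_def)
    moreover have "coeff \<eta> k = (\<Sum>j\<in>?A. if j = k then u (v j) else 0)"
      unfolding \<eta>_def coeff_sum by (intro sum.cong) auto
    then have "\<eta> \<noteq> 0" using u(1,2) by auto
    ultimately show ?thesis by blast
  next
    case False
    then obtain a b where ab: "a \<noteq> b" "v a = v b" by (auto simp: inj_on_def)
    define \<eta> where "\<eta> = monom 1 a + smult (-1) (monom (1::complex) b)"
    have "act (coordinate_poly \<eta> i) g = v a + fscale (-1) (v b)"
      unfolding \<eta>_def coordinate_poly_add coordinate_poly_smult act_add act_scale v_def ..
    then have "act (coordinate_poly \<eta> i) g = 0"
      unfolding ab(2) by (simp only: cfun.scale_minus_left cfun.scale_one right_minus)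
    moreover have "coeff \<eta> a = 1" using ab(1) by (simp add: \<eta>_def)
    then have "\<eta> \<noteq> 0" by auto
    ultimately show ?thesis by blast
  qed
qed

text \<open>
  One coordinate after the other: the parts of \<open>g\<close> with respect to a new coordinate are multiples of \<open>g\<close>, and
  since the action is commutative they inherit the equations that \<open>g\<close> satisfies in the earlier coordinates.
\<close>

lemma primary_decomposition:
  assumes V: "variety conv V" and fin: "finite B" "cfun.span B = V" and "f \<in> V" and "finite D"
  shows "f \<in> cfun.span {g \<in> V. \<forall>i\<in>D. \<exists>\<mu> n. act (coordinate_poly ([:-\<mu>, 1:] ^ n) i) g = 0}"
  using \<open>finite D\<close>
proof (induction D)
  case empty
  show ?case using \<open>f \<in> V\<close> by (intro cfun.span_base) blast
next
  case (insert j D)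
  let ?G = "\<lambda>D. {g \<in> V. \<forall>i\<in>D. \<exists>\<mu> n. act (coordinate_poly ([:-\<mu>, 1:] ^ n) i) g = 0}"
  have "g \<in> cfun.span (?G (insert j D))" if g: "g \<in> ?G D" for g
  proof -
    have "g \<in> V" using g unfolding mem_Collect_eq by (rule conjunct1)
    obtain \<eta> where \<eta>: "\<eta> \<noteq> 0" "act (coordinate_poly \<eta> j) g = 0"
      using ex_annihilating_coordinate_poly[OF V fin \<open>g \<in> V\<close>, of j] by (elim exE conjE)
    note dec = primary_decomposition_coordinate[OF \<eta>]
    show ?thesis
    proof (rule rev_subsetD[OF dec cfun.span_mono], rule subsetI)
      fix h assume "h \<in> {act (coordinate_poly r j) g | r.
        \<exists>\<mu> n. act (coordinate_poly ([:-\<mu>, 1:] ^ n) j) (act (coordinate_poly r j) g) = 0}"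
      then obtain r \<mu> n where h: "h = act (coordinate_poly r j) g"
        and hj: "act (coordinate_poly ([:-\<mu>, 1:] ^ n) j) (act (coordinate_poly r j) g) = 0"
        unfolding mem_Collect_eq by (elim exE conjE)
      have "h \<in> V" unfolding h by (rule act_in_variety[OF V \<open>g \<in> V\<close> coordinate_poly_polynomial])
      moreover have "\<exists>\<mu> n. act (coordinate_poly ([:-\<mu>, 1:] ^ n) i) h = 0" if "i \<in> D" for i
      proof -
        have "\<forall>i\<in>D. \<exists>\<mu> n. act (coordinate_poly ([:-\<mu>, 1:] ^ n) i) g = 0"
          using g unfolding mem_Collect_eq by (rule conjunct2)
        from bspec[OF this that]
        obtain \<mu> n where "act (coordinate_poly ([:-\<mu>, 1:] ^ n) i) g = 0" by (elim exE)
        then have "act (coordinate_poly ([:-\<mu>, 1:] ^ n) i) h = 0"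
          unfolding h act_commute[OF coordinate_poly_polynomial coordinate_poly_polynomial, of _ i]
          by (simp only: act_zero coordinate_poly_polynomial)
        then show ?thesis by (intro exI)
      qed
      moreover have "\<exists>\<mu> n. act (coordinate_poly ([:-\<mu>, 1:] ^ n) j) h = 0"
        unfolding h using hj by (intro exI)
      ultimately show "h \<in> ?G (insert j D)"
        unfolding mem_Collect_eq by (intro conjI ballI) (assumption, erule insertE, simp_all only:)
    qed
  qed
  then have "cfun.span (?G D) \<subseteq> cfun.span (?G (insert j D))"
    by (intro cfun.span_minimal cfun.subspace_span subsetI)
  with insert.IH show ?case by blast
qed

section \<open>Moment functions from curves\<close>

text \<open>
  The composition of the polynomial \<open>p\<close> with the curve \<open>\<phi>\<close>, as a formal polynomial in the parameter. It exists for
  \<open>p \<in> polynomial_functions\<close>, and it is unique because a univariate polynomial over \<open>\<complex>\<close> is determined by its values.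
\<close>

definition pullback :: "('d \<Rightarrow> complex poly) \<Rightarrow> (complex ^ 'd \<Rightarrow> complex) \<Rightarrow> complex poly" where
  "pullback \<phi> p = (SOME P. \<forall>t. poly P t = p (\<chi> i. poly (\<phi> i) t))"

lemma poly_pullback:
  assumes "p \<in> polynomial_functions"
  shows "poly (pullback \<phi> p) t = p (\<chi> i. poly (\<phi> i) t)"
proof -
  have "\<exists>P. \<forall>t. poly P t = p (\<chi> i. poly (\<phi> i) t)"
    using assms unfolding polynomial_functions_shifted[of 0]
  proof (induction rule: span_closure_induct)
    case zero
    show ?case by (rule exI[of _ 0]) simp
  next
    case (add p q)
    then obtain P R where "\<forall>t. poly P t = p (\<chi> i. poly (\<phi> i) t)" "\<forall>t. poly R t = q (\<chi> i. poly (\<phi> i) t)"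
      by (elim exE)
    then show ?case by (intro exI[of _ "P + R"]) simp
  next
    case (scale a p)
    then obtain P where "\<forall>t. poly P t = p (\<chi> i. poly (\<phi> i) t)" by (elim exE)
    then show ?case by (intro exI[of _ "smult a P"]) (simp add: fscale_apply)
  next
    case (base p)
    then obtain k where "p = shifted_monomial 0 k" by blast
    then show ?case
      by (intro exI[of _ "\<Prod>i\<in>UNIV. \<phi> i ^ k i"]) (simp add: shifted_monomial_def poly_prod)
  qed
  then show ?thesis unfolding pullback_def by (rule someI2_ex) blast
qed

lemma pullback_eqI:
  assumes "p \<in> polynomial_functions" "\<And>t. poly P t = p (\<chi> i. poly (\<phi> i) t)"
  shows "pullback \<phi> p = P"
proof -
  have "poly (pullback \<phi> p) = poly P" using assms by (simp add: fun_eq_iff poly_pullback)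
  then show ?thesis by (simp only: poly_eq_poly_eq_iff)
qed

lemma pullback_Q_mult:
  "pullback \<phi> (Q x) * pullback \<phi> (Q y) =
     (\<Sum>w\<in>set_pmf (conv x y). smult (pmf (conv x y) w) (pullback \<phi> (Q w)))"
proof -
  have "poly (pullback \<phi> (Q x) * pullback \<phi> (Q y)) t =
      poly (\<Sum>w\<in>set_pmf (conv x y). smult (pmf (conv x y) w) (pullback \<phi> (Q w))) t" for t
    by (simp add: poly_sum poly_pullback Q_polynomial linearization)
  then show ?thesis unfolding poly_eq_poly_eq_iff[symmetric] by (rule ext)
qed

text \<open>
  The coefficients of \<open>Q x\<close> along the curve multiply by the Cauchy product, because composition with the curve is
  multiplicative and \<open>Q x * Q y\<close> is the convolution average of the \<open>Q w\<close>. Weighting by factorials turns the Cauchy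
  product into the binomial convolution of a moment sequence of rank one.
\<close>

lemma moment_function_of_curve:
  "moment_function conv (\<lambda>x. fact n * coeff (pullback \<phi> (Q x)) n)"
proof -
  define f :: "(nat \<Rightarrow> nat) \<Rightarrow> 'x \<Rightarrow> complex"
    where "f \<alpha> x = fact (\<alpha> 0) * coeff (pullback \<phi> (Q x)) (\<alpha> 0)" for \<alpha> x
  have "pullback \<phi> (Q e) = 1"
    by (rule pullback_eqI[OF Q_polynomial]) (simp add: Q_identity)
  then have "f (\<lambda>i. 0) e = 1" by (simp add: f_def)
  then have nonzero: "f (\<lambda>i. 0) \<noteq> (\<lambda>x. 0)" by auto
  have "conv_eval conv (f \<alpha>) x y =
      (\<Sum>\<beta> | \<beta> \<in> multi_indices 1 \<and> \<beta> \<le> \<alpha>. of_nat (multi_choose 1 \<alpha> \<beta>) * f \<beta> x * f (\<alpha> - \<beta>) y)"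
    if "\<alpha> \<in> multi_indices 1" for \<alpha> x y
  proof -
    let ?m = "\<alpha> 0"
    have "conv_eval conv (f \<alpha>) x y = (\<Sum>w\<in>set_pmf (conv x y). complex_of_real (pmf (conv x y) w) * f \<alpha> w)"
      unfolding conv_eval_def
      by (subst integral_measure_pmf[OF finite_supp]) (auto simp: scaleR_conv_of_real)
    also have "\<dots> = fact ?m * coeff (pullback \<phi> (Q x) * pullback \<phi> (Q y)) ?m"
      unfolding pullback_Q_mult by (simp add: f_def coeff_sum sum_distrib_left mult_ac)
    also have "\<dots> = (\<Sum>j\<le>?m. of_nat (?m choose j) * (fact j * coeff (pullback \<phi> (Q x)) j) *
        (fact (?m - j) * coeff (pullback \<phi> (Q y)) (?m - j)))"
      unfolding coeff_mult sum_distrib_left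
    proof (intro sum.cong refl)
      fix j assume "j \<in> {..?m}"
      then have "(fact ?m :: complex) = of_nat (?m choose j) * fact j * fact (?m - j)"
        by (simp add: binomial_fact)
      then show "fact ?m * (coeff (pullback \<phi> (Q x)) j * coeff (pullback \<phi> (Q y)) (?m - j)) =
          of_nat (?m choose j) * (fact j * coeff (pullback \<phi> (Q x)) j) *
          (fact (?m - j) * coeff (pullback \<phi> (Q y)) (?m - j))"
        by (simp only: mult_ac)
    qed
    also have "\<dots> = (\<Sum>\<beta> | \<beta> \<in> multi_indices 1 \<and> \<beta> \<le> \<alpha>.
        of_nat (multi_choose 1 \<alpha> \<beta>) * f \<beta> x * f (\<alpha> - \<beta>) y)"
      by (rule sum.reindex_bij_witness[of _ "\<lambda>\<beta>. \<beta> 0" "\<lambda>j. (\<lambda>i. 0)(0 := j)"])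
        (auto simp: multi_indices_def le_fun_def multi_choose_def f_def fun_eq_iff Suc_le_eq)
    finally show ?thesis .
  qed
  with nonzero have "moment_sequence conv 1 f" by (simp add: moment_sequence_def)
  moreover have "(\<lambda>i. 0)(0 := n) \<in> multi_indices 1" by (simp add: multi_indices_def)
  moreover have "(\<lambda>x. fact n * coeff (pullback \<phi> (Q x)) n) = f ((\<lambda>i. 0)(0 := n))"
    by (intro ext) (simp add: f_def)
  ultimately show ?thesis unfolding moment_function_def by blast
qed

text \<open>
  This is the moment sequence of a constant curve.
\<close>

lemma moment_function_evaluation: "moment_function conv (\<lambda>x. Q x c)"
proof -
  have "pullback (\<lambda>i. [:c $ i:]) (Q x) = [:Q x c:]" for x
    by (rule pullback_eqI) (simp_all add: Q_polynomial)
  then show ?thesis using moment_function_of_curve[of 0 "\<lambda>i. [:c $ i:]"] by simp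
qed

text \<open>
  Both sides are linear in \<open>p\<close>, so it suffices to compare them on the Taylor monomials at \<open>c\<close>.
\<close>

lemma coeff_pullback:
  assumes "p \<in> polynomial_functions"
    and \<psi>: "\<And>k. coeff (\<Prod>i\<in>UNIV. \<psi> i ^ k i) n = functional h (shifted_monomial c k)"
  shows "coeff (pullback (\<lambda>i. [:c $ i:] + \<psi> i) p) n = functional h p"
proof -
  let ?\<phi> = "\<lambda>i. [:c $ i:] + \<psi> i"
  have "\<exists>P. (\<forall>t. poly P t = p (\<chi> i. poly (?\<phi> i) t)) \<and> coeff P n = functional h p"
    using assms(1) unfolding polynomial_functions_shifted[of c]
  proof (induction rule: span_closure_induct)
    case zero
    show ?case unfolding functional_zero by (rule exI[of _ 0]) simp
  next
    case (add p q)
    then obtain P R where "\<forall>t. poly P t = p (\<chi> i. poly (?\<phi> i) t)" "coeff P n = functional h p"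
      "\<forall>t. poly R t = q (\<chi> i. poly (?\<phi> i) t)" "coeff R n = functional h q"
      by (elim exE conjE)
    then show ?case unfolding functional_add by (intro exI[of _ "P + R"]) simp
  next
    case (scale a p)
    then obtain P where "\<forall>t. poly P t = p (\<chi> i. poly (?\<phi> i) t)" "coeff P n = functional h p"
      by (elim exE conjE)
    then show ?case unfolding functional_scale by (intro exI[of _ "smult a P"]) (simp add: fscale_apply)
  next
    case (base p)
    then obtain k where k: "p = shifted_monomial c k" by blast
    show ?case unfolding k \<psi>[symmetric]
      by (intro exI[of _ "\<Prod>i\<in>UNIV. \<psi> i ^ k i"]) (simp add: shifted_monomial_def poly_prod)
  qed
  then show ?thesis using pullback_eqI[OF assms(1), of _ ?\<phi>] by metis
qed

lemma functional_diff_evaluation: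
  assumes "p \<in> polynomial_functions"
  shows "functional (\<lambda>x. g x - a * Q x c) p = functional g p - a * p c"
  using assms
  by (rule functional_unique[where L = "\<lambda>p. functional g p - a * p c"])
    (simp_all only: functional_add functional_scale functional_Q fscale_apply plus_fun_apply algebra_simps)

text \<open>
  The finiteness assumption says that \<open>g\<close> depends only on finitely many Taylor coefficients at \<open>c\<close>. Take a longest product
  of the \<open>z\<^sub>i - c\<^sub>i\<close> that does not kill \<open>g\<close>. The resulting multiple of \<open>g\<close> is killed by every
  \<open>z\<^sub>i - c\<^sub>i\<close>, hence its functional is a nonzero multiple of evaluation at \<open>c\<close>.
\<close>

lemma local_evaluation_in_variety:
  assumes V: "variety conv V" and "g \<in> V" "g \<noteq> 0"
    and fin: "finite {k. act (shifted_monomial c k) g \<noteq> 0}"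
  shows "(\<lambda>x. Q x c) \<in> V"
proof -
  let ?D = "{k. act (shifted_monomial c k) g \<noteq> 0}"
  have "(\<lambda>i. 0) \<in> ?D" using \<open>g \<noteq> 0\<close> by (simp only: mem_Collect_eq shifted_monomial_zero act_one simp_thms)
  then have "?D \<noteq> {}" by blast
  with fin obtain k where k: "k \<in> ?D" and "Max ((\<lambda>k. \<Sum>i\<in>UNIV. k i) ` ?D) = (\<Sum>i\<in>UNIV. k i)"
    by (rule obtains_MAX)
  then have maximal: "(\<Sum>i\<in>UNIV. l i) \<le> (\<Sum>i\<in>UNIV. k i)" if "l \<in> ?D" for l
    using Max_ge[OF finite_imageI[OF fin] imageI[OF that], of "\<lambda>k. \<Sum>i\<in>UNIV. k i"] by (simp only:)
  define h where "h = act (shifted_monomial c k) g"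
  have "h \<noteq> 0" using k by (simp only: h_def mem_Collect_eq simp_thms)
  have "h \<in> V" unfolding h_def
    by (rule act_in_variety[OF V \<open>g \<in> V\<close> shifted_monomial_polynomial])
  have coord: "act (shifted_monomial c ((\<lambda>i. 0)(j := 1))) h = 0" for j
  proof -
    let ?l = "\<lambda>i. ((\<lambda>i. 0)(j := 1)) i + k i"
    have "(\<Sum>i\<in>UNIV. ?l i) = 1 + (\<Sum>i\<in>UNIV. k i)"
      by (simp add: sum.distrib sum.remove[of UNIV j "(\<lambda>i. 0)(j := 1)"])
    then have "?l \<notin> ?D" using maximal[of ?l] by linarith
    then show ?thesis
      by (simp only: h_def act_act shifted_monomial_polynomial shifted_monomial_mult mem_Collect_eq simp_thms)
  qed
  have scalar: "functional h p = functional h 1 * p c" if "p \<in> polynomial_functions" for p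
    using that unfolding polynomial_functions_shifted[of c]
  proof (induction rule: span_closure_induct)
    case zero
    show ?case unfolding functional_zero by (simp only: zero_fun_apply mult_zero_right)
  next
    case (add p q)
    then show ?case unfolding functional_add by (simp only: plus_fun_apply distrib_left)
  next
    case (scale a p)
    then show ?case unfolding functional_scale by (simp only: fscale_apply mult.left_commute)
  next
    case (base p)
    then obtain m where m: "p = shifted_monomial c m" by blast
    show ?case
    proof (cases "m = (\<lambda>i. 0)")
      case True
      then show ?thesis unfolding m by (simp only: shifted_monomial_zero one_fun_apply mult_1_right)
    next
      case False
      then obtain j where "m j > 0" by (auto simp: fun_eq_iff)
      then have "m = (\<lambda>i. ((\<lambda>i. 0)(j := 1)) i + (m(j := m j - 1)) i)" by (auto simp: fun_eq_iff)
      then have "p = shifted_monomial c ((\<lambda>i. 0)(j := 1)) * shifted_monomial c (m(j := m j - 1))"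
        unfolding m shifted_monomial_mult by (rule arg_cong)
      then have "functional h p = functional (act (shifted_monomial c ((\<lambda>i. 0)(j := 1))) h)
          (shifted_monomial c (m(j := m j - 1)))"
        by (simp only: functional_act shifted_monomial_polynomial)
      also have "\<dots> = 0" unfolding coord functional_eq_act
        by (simp only: act_zero shifted_monomial_polynomial zero_fun_apply)
      finally show ?thesis unfolding m using shifted_monomial_at_center[OF False, of c] by simp
    qed
  qed
  have h: "h x = functional h 1 * Q x c" for x
    using scalar[OF Q_polynomial[of x]] by (simp only: functional_Q)
  have "functional h 1 \<noteq> 0"
  proof
    assume "functional h 1 = 0"
    then have "h = 0" using h by (intro ext) simp
    with \<open>h \<noteq> 0\<close> show False by contradiction
  qed
  then have "fscale (1 / functional h 1) h = (\<lambda>x. Q x c)"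
    by (intro ext) (simp add: fscale_apply h)
  moreover have "fscale (1 / functional h 1) h \<in> V"
    using V \<open>h \<in> V\<close> unfolding variety_def by (intro cfun.subspace_scale) simp_all
  ultimately show ?thesis by simp
qed

text \<open>
  Subtracting \<open>g e\<close> times the evaluation at the common point \<open>c\<close> leaves a functional \<open>g'\<close> that kills constants,
  because \<open>Q e = 1\<close>. Such a functional is a coefficient along a curve through \<open>c\<close>, and hence
  \<open>n!\<close> times it is a moment function.
\<close>

lemma local_in_span_moment_functions:
  assumes V: "variety conv V" and "g \<in> V"
    and loc: "\<And>i. \<exists>\<mu> n. act (coordinate_poly ([:-\<mu>, 1:] ^ n) i) g = 0"
  shows "g \<in> cfun.span {h. moment_function conv h \<and> h \<in> V}"
proof (cases "g = 0")
  case True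
  then show ?thesis by (simp only: cfun.span_zero)
next
  case False
  have sub: "cfun.subspace V" using V by (simp add: variety_def)
  obtain \<mu> N where kill: "\<And>i. act (coordinate_poly ([:-\<mu> i, 1:] ^ N i) i) g = 0"
    using loc by metis
  define c :: "complex ^ 'd" where "c = (\<chi> i. \<mu> i)"
  let ?D = "{k. act (shifted_monomial c k) g \<noteq> 0}"
  \<comment> \<open>A Taylor monomial with \<open>N i\<close> or more factors \<open>z\<^sub>i - c\<^sub>i\<close> for some \<open>i\<close> kills \<open>g\<close>.\<close>
  have "?D \<subseteq> PiE UNIV (\<lambda>i. {..<N i})"
  proof
    fix k assume k: "k \<in> ?D"
    have "k i < N i" for i
    proof (rule ccontr)
      assume "\<not> k i < N i"
      then have "k = (\<lambda>j. (k(i := k i - N i)) j + ((\<lambda>i. 0)(i := N i)) j)" by (auto simp: fun_eq_iff)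
      then have "shifted_monomial c k =
          shifted_monomial c (k(i := k i - N i)) * shifted_monomial c ((\<lambda>i. 0)(i := N i))"
        unfolding shifted_monomial_mult by (rule arg_cong)
      also have "shifted_monomial c ((\<lambda>i. 0)(i := N i)) = coordinate_poly ([:-\<mu> i, 1:] ^ N i) i"
        by (intro ext) (simp only: shifted_monomial_power, simp add: coordinate_poly_def c_def)
      finally have "act (shifted_monomial c k) g =
          act (shifted_monomial c (k(i := k i - N i))) (act (coordinate_poly ([:-\<mu> i, 1:] ^ N i) i) g)"
        by (simp only: act_act shifted_monomial_polynomial)
      also have "\<dots> = 0" unfolding kill by (rule act_zero[OF shifted_monomial_polynomial])
      finally show False using k by blast
    qed
    then show "k \<in> PiE UNIV (\<lambda>i. {..<N i})" by auto
  qed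
  then have fin: "finite ?D" by (rule finite_subset) (auto intro: finite_PiE)
  have E: "(\<lambda>x. Q x c) \<in> V" by (rule local_evaluation_in_variety[OF V \<open>g \<in> V\<close> False fin])
  define g' where "g' = (\<lambda>x. g x - g e * Q x c)"
  have g': "g' = g - fscale (g e) (\<lambda>x. Q x c)" by (intro ext) (simp add: g'_def fscale_apply)
  have "g' \<in> V" unfolding g' using \<open>g \<in> V\<close> E by (intro cfun.subspace_diff cfun.subspace_scale sub)
  define d where "d k = functional g' (shifted_monomial c k)" for k
  have d: "d k = act (shifted_monomial c k) g e - g e * shifted_monomial c k c" for k
    using functional_diff_evaluation[OF shifted_monomial_polynomial[of c k], of g "g e" c]
    by (simp only: d_def g'_def functional_eq_act)
  have d0: "d (\<lambda>i. 0) = 0" unfolding d by (simp only: shifted_monomial_zero act_one) simp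
  have "{k. d k \<noteq> 0} \<subseteq> ?D"
  proof
    fix k assume k: "k \<in> {k. d k \<noteq> 0}"
    then have "k \<noteq> (\<lambda>i. 0)" using d0 by auto
    then have "d k = act (shifted_monomial c k) g e" unfolding d by (simp add: shifted_monomial_at_center)
    with k show "k \<in> ?D" by (auto simp del: zero_fun_apply) (simp add: zero_fun_def)
  qed
  then have "curve_functional d"
    by (intro curve_functional_finite_support d0) (rule finite_subset[OF _ fin])
  then obtain n \<psi> where \<psi>: "\<And>k. coeff (\<Prod>i\<in>UNIV. \<psi> i ^ k i) n = d k"
    unfolding curve_functional_def by (metis zero_less_one)
  define m where "m = (\<lambda>x. fact n * coeff (pullback (\<lambda>i. [:c $ i:] + \<psi> i) (Q x)) n)"
  have "m = fscale (fact n) g'"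
    unfolding m_def using coeff_pullback[OF Q_polynomial \<psi>[unfolded d_def]]
    by (intro ext) (simp only: fscale_apply functional_Q)
  then have m: "m \<in> V" and gm: "g' = fscale (1 / fact n) m"
    using cfun.subspace_scale[OF sub \<open>g' \<in> V\<close>] by (simp_all add: fscale_def)
  have "moment_function conv m" unfolding m_def by (rule moment_function_of_curve)
  then have "g' \<in> cfun.span {h. moment_function conv h \<and> h \<in> V}"
    unfolding gm using m by (intro cfun.span_scale cfun.span_base) simp
  moreover have "fscale (g e) (\<lambda>x. Q x c) \<in> cfun.span {h. moment_function conv h \<and> h \<in> V}"
    using E moment_function_evaluation by (intro cfun.span_scale cfun.span_base) simp
  moreover have "g = g' + fscale (g e) (\<lambda>x. Q x c)" by (simp only: g' diff_add_cancel)
  ultimately show ?thesis using cfun.span_add by metis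
qed

end

theorem corollary5p3:
  fixes conv :: "'x \<Rightarrow> 'x \<Rightarrow> 'x pmf" and e :: 'x and invol :: "'x \<Rightarrow> 'x"
    and Q :: "'x \<Rightarrow> complex ^ 'd::finite \<Rightarrow> complex"
    and f :: "'x \<Rightarrow> complex"
  assumes "polynomial_hypergroup conv e invol Q"
    and "exponential_polynomial conv f"
  shows "f \<in> cfun.span {g. moment_function conv g \<and> g \<in> variety_of conv f}"
proof -
  interpret polynomial_hypergroup conv e invol Q by (rule assms(1))
  let ?V = "variety_of conv f"
  obtain B where B: "finite B" "cfun.span B = ?V"
    using assms(2) unfolding exponential_polynomial_def finite_dimensional_def by blast
  have "f \<in> ?V" unfolding variety_of_def by (rule hull_inc) simp
  from primary_decomposition[OF variety_variety_of B this finite_class.finite_UNIV]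
  have "f \<in> cfun.span {g \<in> ?V. \<forall>i\<in>UNIV. \<exists>\<mu> n. act (coordinate_poly ([:-\<mu>, 1:] ^ n) i) g = 0}" .
  moreover have "cfun.span {g \<in> ?V. \<forall>i\<in>UNIV. \<exists>\<mu> n. act (coordinate_poly ([:-\<mu>, 1:] ^ n) i) g = 0}
      \<subseteq> cfun.span {g. moment_function conv g \<and> g \<in> ?V}"
  proof (intro cfun.span_minimal cfun.subspace_span subsetI)
    fix g assume "g \<in> {g \<in> ?V. \<forall>i\<in>UNIV. \<exists>\<mu> n. act (coordinate_poly ([:-\<mu>, 1:] ^ n) i) g = 0}"
    then have g: "g \<in> ?V \<and> (\<forall>i\<in>UNIV. \<exists>\<mu> n. act (coordinate_poly ([:-\<mu>, 1:] ^ n) i) g = 0)"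
      unfolding mem_Collect_eq .
    show "g \<in> cfun.span {g. moment_function conv g \<and> g \<in> ?V}"
      by (rule local_in_span_moment_functions
          [OF variety_variety_of conjunct1[OF g] bspec[OF conjunct2[OF g] UNIV_I]])
  qed
  ultimately show ?thesis by (rule rev_subsetD)
qed

end
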